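(* Let $n\ge 2$, let $G$ be a weighted graph on $V$ with $|V|=n$ and edge weights $c_{xy}\ge 0$ whose skeleton graph is connected. Then for every $x\in V$ and every $f:\mathcal X_n\to\mathbb R$, $$\sum_{y\in V_x}c_{xy}\,\nu[(\nabla_{xy}f)^2]\;\ge\;\sum_{yz\in E_x}c^{*,x}_{yz}\,\nu[(\nabla_{yz}f)^2].$$
   Context: A weighted graph $G=(V,E)$ is the undirected complete graph on $V=\{1,\dots,n\}$ (so $E$ is the set of all unordered pairs $xy=\{x,y\}$, $x\neq y$) together with real weights $c_{xy}=c_{yx}\ge 0$. Standing assumption: the skeleton graph, with edge set $\{xy\in E:c_{xy}>0\}$, is connected. For $x\in V$: $V_x=V\setminus\{x\}$, $E_x=\{yz\in E: y,z\ne x\}$, and for $yz\in E_x$ $$c^{*,x}_{yz}=\frac{c_{xy}c_{xz}}{\sum_{w\in V_x}c_{xw}}.$$ $\mathcal X_n$ is the set of permutations of $V$, an element $\eta$ being viewed as an assignment of labels $1,\dots,n$ to the vertices ($\eta_x$ is the label at vertex $x$). For $xy\in E$, $\eta^{xy}$ is obtained from $\eta$ by interchanging the labels at $x$ and $y$ (composition of $\eta$ with the transposition $\tau_{xy}$). For $f:\mathcal X_n\to\mathbb R$, $\nabla_{xy}f(\eta)=f(\eta^{xy})-f(\eta)$. $\nu$ is the uniform probability measure on $\mathcal X_n$ and $\nu[f]=\int f\,d\nu=\frac1{n!}\sum_{\eta\in\mathcal X_n}f(\eta)$. *)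

theory Defs
  imports "HOL-Probability.Probability" "HOL-Combinatorics.Combinatorics"
begin

abbreviation verts :: "nat \<Rightarrow> nat set" where
  "verts n \<equiv> {1..n}"

text \<open>Weights are given as a function of two vertices, symmetric on \<open>V\<close>; the diagonal values
  \<open>c x x\<close> are unconstrained, since they are not weights of edges.\<close>

definition weighted_graph :: "nat \<Rightarrow> (nat \<Rightarrow> nat \<Rightarrow> real) \<Rightarrow> bool" where
  "weighted_graph n c \<longleftrightarrow>
     (\<forall>x\<in>verts n. \<forall>y\<in>verts n. x \<noteq> y \<longrightarrow> c x y = c y x \<and> c x y \<ge> 0)"

definition skeleton :: "nat \<Rightarrow> (nat \<Rightarrow> nat \<Rightarrow> real) \<Rightarrow> (nat \<times> nat) set" where
  "skeleton n c = {(x, y). x \<in> verts n \<and> y \<in> verts n \<and> x \<noteq> y \<and> c x y > 0}"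

definition skeleton_connected :: "nat \<Rightarrow> (nat \<Rightarrow> nat \<Rightarrow> real) \<Rightarrow> bool" where
  "skeleton_connected n c \<longleftrightarrow> (\<forall>x\<in>verts n. \<forall>y\<in>verts n. (x, y) \<in> (skeleton n c)\<^sup>*)"

definition verts_minus :: "nat \<Rightarrow> nat \<Rightarrow> nat set" where
  "verts_minus n x = verts n - {x}"

text \<open>An unordered pair \<open>{y, z}\<close> is represented by the ordered pair with \<open>y < z\<close>, so that every
  edge is counted exactly once; see \<open>bij_betw_edges_minus\<close>.\<close>

definition edges_minus :: "nat \<Rightarrow> nat \<Rightarrow> (nat \<times> nat) set" where
  "edges_minus n x = {(y, z). y \<in> verts_minus n x \<and> z \<in> verts_minus n x \<and> y < z}"

lemma bij_betw_edges_minus: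
  "bij_betw (\<lambda>(y, z). {y, z}) (edges_minus n x)
     {{y, z} | y z. y \<in> verts n \<and> z \<in> verts n \<and> y \<noteq> z \<and> y \<noteq> x \<and> z \<noteq> x}"
  unfolding bij_betw_def
proof (intro conjI)
  show "inj_on (\<lambda>(y, z). {y, z}) (edges_minus n x)"
    by (auto simp: inj_on_def edges_minus_def doubleton_eq_iff)
  show "(\<lambda>(y, z). {y, z}) ` edges_minus n x =
     {{y, z} | y z. y \<in> verts n \<and> z \<in> verts n \<and> y \<noteq> z \<and> y \<noteq> x \<and> z \<noteq> x}" (is "_ = ?R")
  proof (intro equalityI subsetI)
    fix e assume "e \<in> ?R"
    then obtain y z where "e = {y, z}" "y \<in> verts n" "z \<in> verts n" "y \<noteq> z" "y \<noteq> x" "z \<noteq> x"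
      by blast
    then have "(min y z, max y z) \<in> edges_minus n x" "e = {min y z, max y z}"
      by (auto simp: edges_minus_def verts_minus_def min_def max_def)
    then show "e \<in> (\<lambda>(y, z). {y, z}) ` edges_minus n x" by force
  qed (fastforce simp: edges_minus_def verts_minus_def)
qed

definition star_weight :: "nat \<Rightarrow> (nat \<Rightarrow> nat \<Rightarrow> real) \<Rightarrow> nat \<Rightarrow> nat \<Rightarrow> nat \<Rightarrow> real" where
  "star_weight n c x y z = c x y * c x z / (\<Sum>w\<in>verts_minus n x. c x w)"

text \<open>A configuration \<open>\<eta>\<close> maps a vertex to its label. As usual for \<open>permutes\<close>, it is extended by
  the identity outside \<open>V\<close>.\<close>

definition configs :: "nat \<Rightarrow> (nat \<Rightarrow> nat) set" where
  "configs n = {\<eta>. \<eta> permutes verts n}"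

definition swap_labels :: "nat \<Rightarrow> nat \<Rightarrow> (nat \<Rightarrow> nat) \<Rightarrow> (nat \<Rightarrow> nat)" where
  "swap_labels x y \<eta> = \<eta> \<circ> Transposition.transpose x y"

definition grad :: "nat \<Rightarrow> nat \<Rightarrow> ((nat \<Rightarrow> nat) \<Rightarrow> real) \<Rightarrow> (nat \<Rightarrow> nat) \<Rightarrow> real" where
  "grad x y f \<eta> = f (swap_labels x y \<eta>) - f \<eta>"

definition unif :: "nat \<Rightarrow> (nat \<Rightarrow> nat) pmf" where
  "unif n = pmf_of_set (configs n)"

abbreviation nu :: "nat \<Rightarrow> ((nat \<Rightarrow> nat) \<Rightarrow> real) \<Rightarrow> real" where
  "nu n f \<equiv> measure_pmf.expectation (unif n) f"

lemma nu_eq_average: "nu n f = (\<Sum>\<eta>\<in>configs n. f \<eta>) / fact n"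
proof -
  have "finite (configs n)" "card (configs n) = fact n"
    by (simp_all add: configs_def finite_permutations card_permutations)
  moreover have "configs n \<noteq> {}"
    using permutes_id unfolding configs_def by blast
  ultimately show ?thesis
    by (simp add: unif_def integral_pmf_of_set)
qed

lemma swap_labels_in_configs:
  assumes "\<eta> \<in> configs n" "x \<in> verts n" "y \<in> verts n"
  shows "swap_labels x y \<eta> \<in> configs n"
  using assms permutes_compose[OF permutes_swap_id[of x "verts n" y], of \<eta>]
  unfolding configs_def swap_labels_def by blast

end

theory Submission
  imports Defs
begin

text \<open>
  Write \<open>S j k\<close> for the operator that exchanges the labels at \<open>j\<close> and \<open>k\<close> before evaluating a
  function, \<open>w y\<close> for \<open>c x y\<close>, \<open>W\<close> for the sum of the \<open>w y\<close>, and \<open>\<langle>_, _\<rangle>\<close> for the inner product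
  of functions on configurations.  Since \<open>S y z\<close> is an isometric involution,
  \<open>\<nu>[(\<nabla>\<^sub>y\<^sub>z f)\<^sup>2]\<close> is a multiple of \<open>\<langle>f, f\<rangle> - \<langle>f, S y z f\<rangle>\<close>, and after multiplication by \<open>W\<close> the claim
  says that \<open>A + E\<close> is a nonnegative operator, where, with all sums over vertices other than \<open>x\<close>,

  \<^item> \<open>E = (\<Sum>j k. w j * w k * K j k)\<close> with \<open>K j k = [j \<noteq> k] S j k - S x j - S x k\<close>,
  \<^item> \<open>A = (\<Sum>j k. w j * w k * (1 + [j = k]))\<close>, a number.

  (Giving \<open>x\<close> the weight \<open>-W\<close>, this is the sum of \<open>w i * w j * S i j\<close> over all ordered pairs.)
  By the Cauchy-Schwarz inequality it is enough that \<open>E\<^sup>2 \<le> A\<^sup>2\<close>.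

  The gain from squaring is that the inequality becomes local.  \<open>A\<^sup>2 - E\<^sup>2\<close> is a sum over
  quadruples \<open>j, k, l, m\<close> with weights \<open>w j * w k * w l * w m \<ge> 0\<close>, and averaging its summand over the
  three ways to pair up \<open>j, k, l, m\<close> gives an operator \<open>gap\<close> (up to a factor 3) which is nonnegative
  for every single quadruple.  In fact \<open>gap\<close> is self-adjoint and \<open>gap\<^sup>2 = 12 gap\<close>, so it is 12 times an
  orthogonal projection (\<open>gap_gap\<close>, \<open>gap_form_nonneg\<close>).  This is a statement about the symmetric
  group of at most five points:

  \<^item> If \<open>j, k, l, m\<close> are distinct, \<open>gap\<close> projects (up to the factor 12) onto the common kernel of
    the Jucys-Murphy element \<open>S x j + S x k + S x l + S x m\<close> and of the sum over the Klein four-group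
    of \<open>{j, k, l, m}\<close>.
  \<^item> If exactly one pair coincides, \<open>gap\<close> is 12 times the difference of the projections onto the
    invariants of the Klein four-group and of \<open>A\<^sub>4\<close>, acting on \<open>x\<close> and the three vertices.
  \<^item> For fewer distinct vertices, \<open>gap\<close> is zero.
\<close>

section \<open>Operators on functions of a configuration\<close>

definition swapped :: "nat \<Rightarrow> nat \<Rightarrow> ((nat \<Rightarrow> nat) \<Rightarrow> real) \<Rightarrow> (nat \<Rightarrow> nat) \<Rightarrow> real" where
  "swapped i j f \<eta> = f (swap_labels i j \<eta>)"

text \<open>The operator \<open>K j k\<close>: the coefficient of \<open>w j * w k\<close> when \<open>x\<close> gets the weight \<open>-W\<close>, without its
  constant term, which is \<open>arm_const\<close>.\<close>

definition arm :: "nat \<Rightarrow> nat \<Rightarrow> nat \<Rightarrow> ((nat \<Rightarrow> nat) \<Rightarrow> real) \<Rightarrow> (nat \<Rightarrow> nat) \<Rightarrow> real" where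
  "arm x j k f \<eta> = (if j = k then 0 else swapped j k f \<eta>) - swapped x j f \<eta> - swapped x k f \<eta>"

definition arm_const :: "nat \<Rightarrow> nat \<Rightarrow> real" where "arm_const j k = (if j = k then 2 else 1)"

text \<open>The summand of \<open>A\<^sup>2 - E\<^sup>2\<close> at \<open>j, k, l, m\<close>, added up over the three pairings of the four
  indices.  The products of \<open>arm\<close>s are symmetrized, so that \<open>gap\<close> is self-adjoint.\<close>

definition gap ::
  "nat \<Rightarrow> nat \<Rightarrow> nat \<Rightarrow> nat \<Rightarrow> nat \<Rightarrow> ((nat \<Rightarrow> nat) \<Rightarrow> real) \<Rightarrow> (nat \<Rightarrow> nat) \<Rightarrow> real" where
  "gap x j k l m f \<eta> =
     (arm_const j k * arm_const l m + arm_const j l * arm_const k m + arm_const j m * arm_const k l) * f \<eta>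
     - (arm x j k (arm x l m f) \<eta> + arm x l m (arm x j k f) \<eta>
      + arm x j l (arm x k m f) \<eta> + arm x k m (arm x j l f) \<eta>
      + arm x j m (arm x k l f) \<eta> + arm x k l (arm x j m f) \<eta>) / 2"

lemma swap_labels_upd: "swap_labels i j \<eta> = \<eta>(i := \<eta> j, j := \<eta> i)"
  by (auto simp: swap_labels_def transpose_def fun_eq_iff)

section \<open>Twelve times a projection\<close>

text \<open>Let \<open>J\<close> be the Jucys-Murphy element \<open>S x j + S x k + S x l + S x m\<close>, \<open>C\<close> the sum of the six
  transpositions of \<open>j, k, l, m\<close>, and \<open>V\<close> the sum over the Klein four-group of these vertices.  Then
  \<open>gap = 12 - V + (C - 2 J) J\<close>, which acts as 12 wherever \<open>J\<close> and \<open>V\<close> vanish; and they vanish on the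
  range of \<open>gap\<close>.  All three identities are linear relations between the values of one function at
  the rearrangements of five labels.\<close>

lemma gap_gap_distinct:
  assumes "distinct [x, j, k, l, m]"
  shows "gap x j k l m (gap x j k l m f) \<eta> = 12 * gap x j k l m f \<eta>"
proof -
  \<comment> \<open>A configuration as a function of the labels at the five vertices, which turns an exchange of
    labels into an exchange of arguments.\<close>
  define u where "u = (\<lambda>p q r s t. \<eta>(j := q, k := r, l := s, m := t, x := p))"
  have ne: "j \<noteq> k" "l \<noteq> m" "j \<noteq> l" "k \<noteq> m" "j \<noteq> m" "k \<noteq> l" "x \<noteq> j" "x \<noteq> k" "x \<noteq> l" "x \<noteq> m"
    using assms by auto
  have sw: "swap_labels x j (u p q r s t) = u q p r s t"
     "swap_labels x k (u p q r s t) = u r q p s t"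
     "swap_labels x l (u p q r s t) = u s q r p t"
     "swap_labels x m (u p q r s t) = u t q r s p"
     "swap_labels j k (u p q r s t) = u p r q s t"
     "swap_labels j l (u p q r s t) = u p s r q t"
     "swap_labels j m (u p q r s t) = u p t r s q"
     "swap_labels k l (u p q r s t) = u p q s r t"
     "swap_labels k m (u p q r s t) = u p q t s r"
     "swap_labels l m (u p q r s t) = u p q r t s" for p q r s t
    by (simp_all add: u_def swap_labels_upd ne ne[symmetric] fun_upd_twist)
  \<comment> \<open>Double transpositions fixing \<open>x\<close> have coefficient -1, those moving \<open>x\<close> have 1, and the
    3-cycles moving \<open>x\<close> have -1.\<close>
  have g: "gap x j k l m h (u p q r s t) = 3 * h (u p q r s t)
    - h (u p r q t s) - h (u p s t q r) - h (u p t s r q)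
    + h (u q p r t s) + h (u q p s r t) + h (u q p t s r)
    + h (u r q p t s) + h (u r s p q t) + h (u r t p s q)
    + h (u s q t p r) + h (u s r q p t) + h (u s t r p q)
    + h (u t q s r p) + h (u t r q s p) + h (u t s r q p)
    - h (u q r p s t) - h (u r p q s t) - h (u q s r p t) - h (u s p r q t)
    - h (u q t r s p) - h (u t p r s q) - h (u r q s p t) - h (u s q p r t)
    - h (u r q t s p) - h (u t q p s r) - h (u s q r t p) - h (u t q r p s)" for h p q r s t
    by (simp add: gap_def arm_def swapped_def arm_const_def ne sw field_simps)
  define J where "J = (\<lambda>h p q r s t.
    h (u q p r s t) + h (u r q p s t) + h (u s q r p t) + h (u t q r s p) :: real)"
  define V where "V = (\<lambda>h p q r s t.
    h (u p q r s t) + h (u p r q t s) + h (u p s t q r) + h (u p t s r q) :: real)"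
  have J: "J (gap x j k l m h) p q r s t = 0" for h p q r s t
    unfolding J_def g by linarith
  have V: "V (gap x j k l m h) p q r s t = 0" for h p q r s t
    unfolding V_def g by linarith
  \<comment> \<open>The sum over six rearrangements is \<open>C J h\<close>, the one over four is \<open>J J h\<close>.\<close>
  have decomposition: "gap x j k l m h (u p q r s t) = 12 * h (u p q r s t) - V h p q r s t
      + (J h p r q s t + J h p s r q t + J h p t r s q + J h p q s r t + J h p q t s r + J h p q r t s)
      - 2 * (J h q p r s t + J h r q p s t + J h s q r p t + J h t q r s p)" for h p q r s t
    unfolding J_def V_def g by (simp add: algebra_simps)
  have "gap x j k l m (gap x j k l m f) (u p q r s t) = 12 * gap x j k l m f (u p q r s t)" for p q r s t
    by (subst decomposition) (simp add: J V)
  moreover have "u (\<eta> x) (\<eta> j) (\<eta> k) (\<eta> l) (\<eta> m) = \<eta>"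
    by (simp add: u_def)
  ultimately show ?thesis by metis
qed

text \<open>Here \<open>gap\<close> is three times the sum over the Klein four-group of \<open>{x, j, l, m}\<close> minus the sum over
  \<open>A\<^sub>4\<close>.  A function in its range is invariant under the four-group, so it depends only on the coset,
  and its values at the three cosets add up to zero.\<close>

lemma gap_gap_one_coincidence:
  assumes "distinct [x, j, l, m]"
  shows "gap x j j l m (gap x j j l m f) \<eta> = 12 * gap x j j l m f \<eta>"
proof -
  define u where "u = (\<lambda>p q s t. \<eta>(x := p, j := q, l := s, m := t))"
  have sw: "swap_labels x j (u p q s t) = u q p s t"
     "swap_labels x l (u p q s t) = u s q p t"
     "swap_labels x m (u p q s t) = u t q s p"
     "swap_labels j l (u p q s t) = u p s q t"
     "swap_labels j m (u p q s t) = u p t s q"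
     "swap_labels l m (u p q s t) = u p q t s" for p q s t
    using assms by (auto simp: u_def swap_labels_def fun_eq_iff transpose_def)
  have ne: "l \<noteq> m" "j \<noteq> l" "j \<noteq> m"
    using assms by auto
  have g: "gap x j j l m h (u p q s t) =
      2 * h (u p q s t) + 2 * h (u q p t s) + 2 * h (u s t p q) + 2 * h (u t s q p)
    - h (u p s t q) - h (u p t q s) - h (u s q t p) - h (u t q p s)
    - h (u q t s p) - h (u t p s q) - h (u q s p t) - h (u s p q t)" for h p q s t
    by (simp add: gap_def arm_def swapped_def arm_const_def ne sw field_simps)
  define X where "X = gap x j j l m f"
  have V: "X (u q p t s) = X (u p q s t)" "X (u s t p q) = X (u p q s t)"
    "X (u t s q p) = X (u p q s t)" for p q s t
    unfolding X_def g by linarith+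
  have C: "X (u p q s t) + X (u p s t q) + X (u p t q s) = 0" for p q s t
    unfolding X_def g by linarith
  have "gap x j j l m X (u p q s t) = 12 * X (u p q s t)" for p q s t
    unfolding g using V[of p q s t] V[of p s t q] V[of p t q s] C[of p q s t] by linarith
  moreover have "u (\<eta> x) (\<eta> j) (\<eta> l) (\<eta> m) = \<eta>"
    by (simp add: u_def)
  ultimately show ?thesis unfolding X_def by metis
qed

text \<open>With three vertices left, only the two 3-cycles of \<open>x, j, l\<close> could occur besides the identity, and
  all three coefficients cancel.\<close>

lemma gap_two_values:
  assumes "distinct [x, j, l]"
  shows "gap x j j l l f \<eta> = 0" "gap x j j j l f \<eta> = 0" "gap x j j l j f \<eta> = 0"
proof -
  define u where "u = (\<lambda>p q s. \<eta>(x := p, j := q, l := s))"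
  have sw: "swap_labels x j (u p q s) = u q p s"
     "swap_labels x l (u p q s) = u s q p"
     "swap_labels j l (u p q s) = u p s q"
     "swap_labels l j (u p q s) = u p s q" for p q s
    using assms by (auto simp: u_def swap_labels_def fun_eq_iff transpose_def)
  have ne: "j \<noteq> l" "l \<noteq> j"
    using assms by auto
  have u: "u (\<eta> x) (\<eta> j) (\<eta> l) = \<eta>"
    by (simp add: u_def)
  have "gap x j j l l f (u p q s) = 0" "gap x j j j l f (u p q s) = 0"
    "gap x j j l j f (u p q s) = 0" for p q s
    by (simp_all add: gap_def arm_def swapped_def arm_const_def ne sw)
  with u show "gap x j j l l f \<eta> = 0" "gap x j j j l f \<eta> = 0" "gap x j j l j f \<eta> = 0"
    by metis+
qed

lemma swapped_commute: "swapped j i = swapped i j"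
  by (simp add: swapped_def swap_labels_def transpose_commute fun_eq_iff)

lemma arm_commute: "arm x k j = arm x j k"
  by (simp add: arm_def fun_eq_iff swapped_commute)

lemma arm_const_commute: "arm_const k j = arm_const j k"
  by (simp add: arm_const_def)

text \<open>These three exchanges generate all permutations of the four indices.\<close>

lemma gap_perm:
  "gap x k j l m = gap x j k l m" "gap x j l k m = gap x j k l m" "gap x j k m l = gap x j k l m"
  by (simp_all add: fun_eq_iff gap_def arm_commute arm_const_commute algebra_simps)

lemma gap_one_value: "gap x j j j j f \<eta> = 0"
proof -
  have "swap_labels x j (swap_labels x j \<eta>) = \<eta>"
    by (simp add: swap_labels_def fun_eq_iff)
  then show ?thesis
    by (simp add: gap_def arm_def arm_const_def swapped_def)
qed

lemma gap_gap_repeated: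
  assumes "x \<notin> {j, l, m}"
  shows "gap x j j l m (gap x j j l m f) \<eta> = 12 * gap x j j l m f \<eta>"
proof -
  consider "distinct [x, j, l, m]" | "l = m" "j \<noteq> l" | "j = l" "j \<noteq> m" | "j = m" "j \<noteq> l" | "j = l" "j = m"
    using assms by auto
  then show ?thesis
  proof cases
    case 1 then show ?thesis by (rule gap_gap_one_coincidence)
  next
    case 2 then show ?thesis using gap_two_values(1)[of x j l] assms by simp
  next
    case 3 then show ?thesis using gap_two_values(2)[of x j m] assms by simp
  next
    case 4 then show ?thesis using gap_two_values(3)[of x j l] assms by simp
  next
    case 5 then show ?thesis by (simp add: gap_one_value)
  qed
qed

lemma gap_gap:
  assumes "x \<notin> {j, k, l, m}"
  shows "gap x j k l m (gap x j k l m f) \<eta> = 12 * gap x j k l m f \<eta>"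
proof (cases "distinct [j, k, l, m]")
  case True
  then show ?thesis using assms by (intro gap_gap_distinct) auto
next
  case False
  then obtain a b c where "gap x j k l m = gap x a a b c" "{a, b, c} \<subseteq> {j, k, l, m}"
    by (auto; metis gap_perm insertCI empty_subsetI insert_subset)
  moreover from this have "x \<notin> {a, b, c}" using assms by blast
  ultimately show ?thesis by (simp add: gap_gap_repeated)
qed

section \<open>The quadratic forms of the operators\<close>

definition conf_inner :: "nat \<Rightarrow> ((nat \<Rightarrow> nat) \<Rightarrow> real) \<Rightarrow> ((nat \<Rightarrow> nat) \<Rightarrow> real) \<Rightarrow> real" where
  "conf_inner n f g = (\<Sum>\<eta>\<in>configs n. f \<eta> * g \<eta>)"

lemma conf_inner_commute: "conf_inner n f g = conf_inner n g f"
  by (simp add: conf_inner_def mult.commute)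

lemma conf_inner_self_nonneg: "conf_inner n f f \<ge> 0"
  by (simp add: conf_inner_def sum_nonneg)

lemma conf_inner_sum_left:
  "conf_inner n (\<lambda>\<eta>. \<Sum>i\<in>I. w i * F i \<eta>) g = (\<Sum>i\<in>I. w i * conf_inner n (F i) g)"
  unfolding conf_inner_def sum_distrib_left sum_distrib_right
  by (subst sum.swap) (simp add: mult.assoc)

text \<open>Exchanging two labels is an involution of the configurations, hence a self-adjoint operator.\<close>

lemma swapped_self_adjoint:
  assumes "i \<in> verts n" "j \<in> verts n"
  shows "conf_inner n (swapped i j f) g = conf_inner n f (swapped i j g)"
proof -
  have "swap_labels i j (swap_labels i j \<eta>) = \<eta>" for \<eta>
    by (simp add: swap_labels_def fun_eq_iff)
  then show ?thesis
    unfolding conf_inner_def swapped_def using assms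
    by (intro sum.reindex_bij_witness[of _ "swap_labels i j" "swap_labels i j"])
       (auto simp: swap_labels_in_configs)
qed

lemma conf_inner_arm_left:
  "conf_inner n (arm x j k f) g = (if j = k then 0 else conf_inner n (swapped j k f) g)
     - conf_inner n (swapped x j f) g - conf_inner n (swapped x k f) g"
  by (simp add: conf_inner_def arm_def algebra_simps sum_subtractf sum.distrib sum_distrib_left)

lemma arm_self_adjoint:
  assumes "x \<in> verts n" "j \<in> verts n" "k \<in> verts n"
  shows "conf_inner n (arm x j k f) g = conf_inner n f (arm x j k g)"
  using assms by (subst (2) conf_inner_commute)
    (simp only: conf_inner_arm_left swapped_self_adjoint conf_inner_commute[of n g])

lemma conf_inner_gap_left:
  "conf_inner n (gap x j k l m f) g =
     (arm_const j k * arm_const l m + arm_const j l * arm_const k m + arm_const j m * arm_const k l)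
       * conf_inner n f g
     - (conf_inner n (arm x j k (arm x l m f)) g + conf_inner n (arm x l m (arm x j k f)) g
      + conf_inner n (arm x j l (arm x k m f)) g + conf_inner n (arm x k m (arm x j l f)) g
      + conf_inner n (arm x j m (arm x k l f)) g + conf_inner n (arm x k l (arm x j m f)) g) / 2"
  by (simp add: conf_inner_def gap_def sum_subtractf sum.distrib sum_distrib_left sum_divide_distrib
      left_diff_distrib distrib_right add_divide_distrib mult.assoc)

lemma gap_self_adjoint:
  assumes "x \<in> verts n" "j \<in> verts n" "k \<in> verts n" "l \<in> verts n" "m \<in> verts n"
  shows "conf_inner n (gap x j k l m f) g = conf_inner n f (gap x j k l m g)"
  using assms by (subst (2) conf_inner_commute)
    (simp add: conf_inner_gap_left arm_self_adjoint conf_inner_commute[of n g])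

text \<open>A self-adjoint \<open>R\<close> with \<open>R\<^sup>2 = 12 R\<close> satisfies \<open>12 \<langle>R f, f\<rangle> = \<langle>R f, R f\<rangle>\<close>.\<close>

lemma gap_form_nonneg:
  assumes "x \<in> verts n" "{j, k, l, m} \<subseteq> verts_minus n x"
  shows "conf_inner n (gap x j k l m f) f \<ge> 0"
proof -
  let ?R = "gap x j k l m"
  have V: "j \<in> verts n" "k \<in> verts n" "l \<in> verts n" "m \<in> verts n" "x \<notin> {j, k, l, m}"
    using assms by (auto simp: verts_minus_def)
  have "conf_inner n (?R f) (?R f) = conf_inner n (?R (?R f)) f"
    using assms(1) V by (simp add: gap_self_adjoint)
  also have "\<dots> = 12 * conf_inner n (?R f) f"
    using V by (simp add: conf_inner_def gap_gap sum_distrib_left mult.assoc)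
  finally show ?thesis using conf_inner_self_nonneg[of n "?R f"] by simp
qed

text \<open>Under the quadratic form, the two orders of a product of \<open>arm\<close>s agree, and each turns into an inner
  product of two \<open>arm\<close>s of \<open>f\<close>.\<close>

lemma gap_form:
  fixes f :: "(nat \<Rightarrow> nat) \<Rightarrow> real"
  assumes "x \<in> verts n" "{j, k, l, m} \<subseteq> verts_minus n x"
  defines "P \<equiv> \<lambda>j k l m. arm_const j k * arm_const l m * conf_inner n f f
    - conf_inner n (arm x j k f) (arm x l m f)"
  shows "conf_inner n (gap x j k l m f) f = P j k l m + P j l k m + P j m k l"
proof -
  have V: "j \<in> verts n" "k \<in> verts n" "l \<in> verts n" "m \<in> verts n"
    using assms by (auto simp: verts_minus_def)
  have "conf_inner n (arm x b c (arm x d e f)) f = conf_inner n (arm x d e f) (arm x b c f)"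
    if "b \<in> verts n" "c \<in> verts n" for b c d e
    using that assms(1) by (simp add: arm_self_adjoint)
  with V show ?thesis
    unfolding conf_inner_gap_left P_def
    by (simp add: conf_inner_commute[of n "arm x l m f"]
        conf_inner_commute[of n "arm x k m f"] conf_inner_commute[of n "arm x k l f"] algebra_simps)
qed

section \<open>The inequality for a star\<close>

text \<open>The weight is symmetric in the four indices, so the three pairings contribute equally.\<close>

lemma sum_pairings:
  fixes w :: "'a \<Rightarrow> real"
  shows "(\<Sum>j\<in>A. \<Sum>k\<in>A. \<Sum>l\<in>A. \<Sum>m\<in>A. w j * w k * w l * w m * (P j k l m + P j l k m + P j m k l))
    = 3 * (\<Sum>j\<in>A. \<Sum>k\<in>A. \<Sum>l\<in>A. \<Sum>m\<in>A. w j * w k * w l * w m * P j k l m)"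
proof -
  have 1: "(\<Sum>j\<in>A. \<Sum>k\<in>A. \<Sum>l\<in>A. \<Sum>m\<in>A. w j * w k * w l * w m * P j l k m)
     = (\<Sum>j\<in>A. \<Sum>k\<in>A. \<Sum>l\<in>A. \<Sum>m\<in>A. w j * w k * w l * w m * P j k l m)"
    by (rule sum.cong[OF refl], subst sum.swap) (simp add: mult_ac)
  have 2: "(\<Sum>j\<in>A. \<Sum>k\<in>A. \<Sum>l\<in>A. \<Sum>m\<in>A. w j * w k * w l * w m * P j m k l)
     = (\<Sum>j\<in>A. \<Sum>k\<in>A. \<Sum>m\<in>A. \<Sum>l\<in>A. w j * w k * w l * w m * P j m k l)"
    by (rule sum.cong[OF refl], rule sum.cong[OF refl], rule sum.swap)
  also have "\<dots> = (\<Sum>j\<in>A. \<Sum>k\<in>A. \<Sum>l\<in>A. \<Sum>m\<in>A. w j * w k * w l * w m * P j k l m)"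
    by (rule sum.cong[OF refl], subst sum.swap) (simp add: mult_ac)
  finally show ?thesis
    by (simp add: distrib_left sum.distrib 1)
qed

text \<open>The operator \<open>A + E\<close> is nonnegative: summing \<open>gap_form_nonneg\<close> over all quadruples gives
  \<open>\<langle>E f, E f\<rangle> \<le> A\<^sup>2 \<langle>f, f\<rangle>\<close>, and so \<open>\<bar>\<langle>E f, f\<rangle>\<bar> \<le> A \<langle>f, f\<rangle>\<close> by Cauchy-Schwarz.\<close>

lemma star_form_nonneg:
  fixes w :: "nat \<Rightarrow> real" and f :: "(nat \<Rightarrow> nat) \<Rightarrow> real"
  assumes x: "x \<in> verts n" and w: "\<And>j. j \<in> verts_minus n x \<Longrightarrow> w j \<ge> 0"
  defines "V \<equiv> verts_minus n x"
  shows "0 \<le> (\<Sum>j\<in>V. \<Sum>k\<in>V. w j * w k * (arm_const j k * conf_inner n f f + conf_inner n (arm x j k f) f))"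
proof -
  define A where "A = (\<Sum>j\<in>V. \<Sum>k\<in>V. w j * w k * arm_const j k)"
  define E where "E = (\<lambda>\<eta>. \<Sum>j\<in>V. w j * (\<Sum>k\<in>V. w k * arm x j k f \<eta>))"
  define P where "P = (\<lambda>j k l m. arm_const j k * arm_const l m * conf_inner n f f
    - conf_inner n (arm x j k f) (arm x l m f))"
  have w: "w j \<ge> 0" if "j \<in> V" for j using w that by (simp add: V_def)
  have E: "conf_inner n E g = (\<Sum>j\<in>V. \<Sum>k\<in>V. w j * w k * conf_inner n (arm x j k f) g)" for g
    unfolding E_def conf_inner_sum_left by (simp add: sum_distrib_left mult.assoc)
  have "A\<^sup>2 * conf_inner n f f - conf_inner n E E =
      (\<Sum>j\<in>V. \<Sum>k\<in>V. \<Sum>l\<in>V. \<Sum>m\<in>V. w j * w k * w l * w m * P j k l m)"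
  proof -
    have "A\<^sup>2 * conf_inner n f f = (\<Sum>j\<in>V. \<Sum>k\<in>V. \<Sum>l\<in>V. \<Sum>m\<in>V.
        w j * w k * w l * w m * (arm_const j k * arm_const l m * conf_inner n f f))"
      unfolding power2_eq_square A_def sum_distrib_left sum_distrib_right by (simp add: mult_ac)
    moreover have "conf_inner n E E = (\<Sum>j\<in>V. \<Sum>k\<in>V. \<Sum>l\<in>V. \<Sum>m\<in>V.
        w j * w k * w l * w m * conf_inner n (arm x j k f) (arm x l m f))"
      by (subst E, subst conf_inner_commute, subst E) (simp add: sum_distrib_left mult_ac conf_inner_commute)
    ultimately show ?thesis
      by (simp add: P_def right_diff_distrib sum_subtractf)
  qed
  moreover have "0 \<le> (\<Sum>j\<in>V. \<Sum>k\<in>V. \<Sum>l\<in>V. \<Sum>m\<in>V.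
      w j * w k * w l * w m * (P j k l m + P j l k m + P j m k l))"
  proof (intro sum_nonneg mult_nonneg_nonneg)
    fix j k l m assume "j \<in> V" "k \<in> V" "l \<in> V" "m \<in> V"
    then have "{j, k, l, m} \<subseteq> verts_minus n x" by (simp add: V_def)
    with x show "0 \<le> P j k l m + P j l k m + P j m k l"
      using gap_form_nonneg[of x n j k l m f] gap_form[of x n j k l m f] by (simp add: P_def)
  qed (use w in auto)
  ultimately have *: "conf_inner n E E \<le> A\<^sup>2 * conf_inner n f f"
    by (simp add: sum_pairings)
  have "A \<ge> 0" unfolding A_def using w by (auto intro!: sum_nonneg simp: arm_const_def)
  have "(conf_inner n E f)\<^sup>2 \<le> conf_inner n E E * conf_inner n f f"
    using Cauchy_Schwarz_ineq_sum[of E f "configs n"] by (simp add: conf_inner_def power2_eq_square)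
  also have "\<dots> \<le> A\<^sup>2 * conf_inner n f f * conf_inner n f f"
    using * conf_inner_self_nonneg by (rule mult_right_mono)
  also have "\<dots> = (A * conf_inner n f f)\<^sup>2"
    by (simp add: power2_eq_square)
  finally have "\<bar>conf_inner n E f\<bar> \<le> A * conf_inner n f f"
    using \<open>A \<ge> 0\<close> conf_inner_self_nonneg[of n f] by (simp add: abs_le_square_iff[symmetric] abs_mult)
  then have "0 \<le> A * conf_inner n f f + conf_inner n E f" by linarith
  also have "\<dots> = (\<Sum>j\<in>V. \<Sum>k\<in>V. w j * w k * (arm_const j k * conf_inner n f f + conf_inner n (arm x j k f) f))"
    unfolding E A_def by (simp add: sum_distrib_left sum.distrib algebra_simps)
  finally show ?thesis .
qed

section \<open>Dirichlet forms\<close>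

lemma nu_grad:
  assumes "i \<in> verts n" "j \<in> verts n"
  shows "nu n (\<lambda>\<eta>. (grad i j f \<eta>)\<^sup>2) = 2 * (conf_inner n f f - conf_inner n (swapped i j f) f) / fact n"
proof -
  have inv: "swapped i j (swapped i j f) = f"
    by (simp add: swapped_def swap_labels_def fun_eq_iff comp_assoc)
  have "(\<Sum>\<eta>\<in>configs n. (grad i j f \<eta>)\<^sup>2) =
      conf_inner n (swapped i j f) (swapped i j f) + conf_inner n f f - 2 * conf_inner n (swapped i j f) f"
    by (simp add: conf_inner_def grad_def swapped_def power2_eq_square
        algebra_simps sum.distrib sum_subtractf sum_distrib_left)
  also have "conf_inner n (swapped i j f) (swapped i j f) = conf_inner n f f"
    using assms by (simp add: swapped_self_adjoint inv)
  finally show ?thesis by (simp add: nu_eq_average)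
qed

lemma sum_edges:
  fixes g :: "nat \<Rightarrow> nat \<Rightarrow> real" and n x :: nat
  assumes "\<And>j k. g j k = g k j"
  defines "V \<equiv> verts_minus n x"
  shows "(\<Sum>j\<in>V. \<Sum>k\<in>V. if j = k then 0 else g j k) = 2 * (\<Sum>(j, k)\<in>edges_minus n x. g j k)"
proof -
  let ?L = "edges_minus n x" and ?G = "prod.swap ` edges_minus n x"
  have fin: "finite V" by (simp add: V_def verts_minus_def)
  have off_diagonal: "?L \<union> ?G = {(j, k). j \<in> V \<and> k \<in> V \<and> j \<noteq> k}"
    by (auto simp: edges_minus_def V_def pair_in_swap_image)
  have sub: "?L \<subseteq> V \<times> V" "?G \<subseteq> V \<times> V" by (auto simp: edges_minus_def V_def)
  have "finite ?L" "finite ?G"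
    using fin sub by (meson finite_SigmaI finite_subset)+
  have "(\<Sum>j\<in>V. \<Sum>k\<in>V. if j = k then 0 else g j k) = (\<Sum>(j, k)\<in>V \<times> V. if j = k then 0 else g j k)"
    by (simp add: sum.cartesian_product)
  also have "\<dots> = (\<Sum>(j, k)\<in>?L \<union> ?G. g j k)"
    unfolding off_diagonal using fin by (intro sum.mono_neutral_cong_right) auto
  also have "\<dots> = (\<Sum>(j, k)\<in>?L. g j k) + (\<Sum>(j, k)\<in>?G. g j k)"
    using \<open>finite ?L\<close> \<open>finite ?G\<close> by (intro sum.union_disjoint) (auto simp: edges_minus_def)
  also have "(\<Sum>(j, k)\<in>?G. g j k) = (\<Sum>(j, k)\<in>?L. g j k)"
    using assms(1) by (subst sum.reindex) (auto simp: case_prod_unfold intro!: sum.cong)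
  finally show ?thesis by simp
qed

theorem theorem2p3:
  fixes n :: nat and c :: "nat \<Rightarrow> nat \<Rightarrow> real" and x :: nat
    and f :: "(nat \<Rightarrow> nat) \<Rightarrow> real"
  assumes "n \<ge> 2"
    and "weighted_graph n c"
    and "skeleton_connected n c"
    and "x \<in> verts n"
  shows "(\<Sum>y\<in>verts_minus n x. c x y * nu n (\<lambda>\<eta>. (grad x y f \<eta>)\<^sup>2))
       \<ge> (\<Sum>(y, z)\<in>edges_minus n x. star_weight n c x y z * nu n (\<lambda>\<eta>. (grad y z f \<eta>)\<^sup>2))"
proof -
  define V where "V = verts_minus n x"
  define w where "w = c x"
  define W where "W = (\<Sum>y\<in>V. w y)"
  define u where "u = (\<lambda>i j. conf_inner n f f - conf_inner n (swapped i j f) f)"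
  have w: "w y \<ge> 0" if "y \<in> V" for y
    using assms(2,4) that by (auto simp: weighted_graph_def w_def V_def verts_minus_def)
  have fin: "finite V" by (simp add: V_def verts_minus_def)
  have nu: "nu n (\<lambda>\<eta>. (grad i j f \<eta>)\<^sup>2) = 2 / fact n * u i j" if "i \<in> verts n" "j \<in> verts n" for i j
    using that by (simp add: nu_grad u_def)
  have sym: "u i j = u j i" for i j
    by (simp add: u_def swapped_commute)
  \<comment> \<open>A path of the skeleton from \<open>x\<close> to another vertex starts with an edge at \<open>x\<close>.\<close>
  have "W > 0"
  proof -
    define y where "y = (if x = 1 then 2 else 1 :: nat)"
    have "y \<in> verts n" "y \<noteq> x"
      using assms(1) by (auto simp: y_def)
    then have "(x, y) \<in> (skeleton n c)\<^sup>*" using assms(3,4) by (auto simp: skeleton_connected_def)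
    then obtain z where "(x, z) \<in> skeleton n c"
      using \<open>y \<noteq> x\<close> by (metis converse_rtranclE)
    then have "z \<in> V" "w z > 0" by (auto simp: skeleton_def V_def verts_minus_def w_def)
    then show ?thesis unfolding W_def using w fin by (intro sum_pos2[of _ z]) auto
  qed
  have "0 \<le> (\<Sum>j\<in>V. \<Sum>k\<in>V. w j * w k * (arm_const j k * conf_inner n f f + conf_inner n (arm x j k f) f))"
    unfolding V_def using assms(4) w V_def by (intro star_form_nonneg) auto
  \<comment> \<open>The constants were chosen so that the form at \<open>j, k\<close> is \<open>u x j + u x k - u j k\<close>, with
    \<open>u j j = 0\<close>.\<close>
  also have "\<dots> = (\<Sum>j\<in>V. \<Sum>k\<in>V. w k * (w j * u x j) + w j * (w k * u x k)
      - (if j = k then 0 else w j * w k * u j k))"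
    by (intro sum.cong refl) (auto simp: arm_const_def conf_inner_arm_left u_def algebra_simps)
  also have "\<dots> = 2 * (W * (\<Sum>y\<in>V. w y * u x y)) - 2 * (\<Sum>(y, z)\<in>edges_minus n x. w y * w z * u y z)"
  proof -
    have "(\<Sum>j\<in>V. \<Sum>k\<in>V. w k * (w j * u x j)) = W * (\<Sum>y\<in>V. w y * u x y)"
      unfolding W_def by (simp add: sum_product) (subst sum.swap, simp)
    moreover have "(\<Sum>j\<in>V. \<Sum>k\<in>V. w j * (w k * u x k)) = W * (\<Sum>y\<in>V. w y * u x y)"
      unfolding W_def by (simp add: sum_product)
    moreover have "(\<Sum>j\<in>V. \<Sum>k\<in>V. if j = k then 0 else w j * w k * u j k)
        = 2 * (\<Sum>(y, z)\<in>edges_minus n x. w y * w z * u y z)"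
      unfolding V_def by (rule sum_edges) (simp add: sym mult_ac)
    ultimately show ?thesis by (simp add: sum_subtractf sum.distrib)
  qed
  finally have main: "(\<Sum>(y, z)\<in>edges_minus n x. w y * w z * u y z) / W \<le> (\<Sum>y\<in>V. w y * u x y)"
    using \<open>W > 0\<close> by (simp add: field_simps)
  have "(\<Sum>(y, z)\<in>edges_minus n x. star_weight n c x y z * nu n (\<lambda>\<eta>. (grad y z f \<eta>)\<^sup>2))
      = (\<Sum>(y, z)\<in>edges_minus n x. 2 / fact n * (w y * w z * u y z / W))"
    by (intro sum.cong refl) (auto simp: nu edges_minus_def verts_minus_def star_weight_def w_def W_def V_def)
  also have "\<dots> = 2 / fact n * ((\<Sum>(y, z)\<in>edges_minus n x. w y * w z * u y z) / W)"
    by (simp add: sum_divide_distrib sum_distrib_left case_prod_unfold)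
  also have "\<dots> \<le> 2 / fact n * (\<Sum>y\<in>V. w y * u x y)"
    using main by (intro mult_left_mono) auto
  also have "\<dots> = (\<Sum>y\<in>verts_minus n x. c x y * nu n (\<lambda>\<eta>. (grad x y f \<eta>)\<^sup>2))"
    unfolding sum_distrib_left using assms(4)
    by (intro sum.cong) (auto simp: nu V_def verts_minus_def w_def)
  finally show ?thesis .
qed

end
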